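(* Let $p\ge 1$ and let $H\in\mathbb{R}^{p\times p}$ be symmetric positive semidefinite with $H_{ii}=1$ for all $i$. Let $T$ be the strictly lower triangular part of $H$ ($T_{ij}=H_{ij}$ for $i>j$, $T_{ij}=0$ otherwise), put $\rho=\|H\|$, and let $\kappa>0$. Define $$A_{\rm WL}=2(\rho+2+\rho\sqrt p)\bigl(1+\kappa(2+\rho\sqrt p)\bigr),\qquad \chi_{\rm WL}=\frac{A_{\rm WL}}{1+A_{\rm WL}}.$$ Then $$\frac{2\kappa\|T\|^2}{1+2\kappa\|T\|^2}<\chi_{\rm WL}.$$
   Context: $\|\cdot\|$ is the spectral norm (matrix norm induced by the Euclidean norm). Here $\kappa$ plays the role of a global residual error-bound constant for minimizing $\tfrac12x^\top Hx-a^\top x$ over a box, and $\chi_{\rm WL}$ is the Wang--Lin contraction factor for exact cyclic coordinate minimization with that constant. *)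

theory Defs
  imports "HOL-Analysis.Analysis"
begin

definition spectral_norm :: "real ^ 'n ^ 'm \<Rightarrow> real" where
  "spectral_norm A = onorm ((*v) A)"

definition symmetric_psd :: "real ^ 'n ^ 'n \<Rightarrow> bool" where
  "symmetric_psd A \<longleftrightarrow> transpose A = A \<and> (\<forall>x. 0 \<le> x \<bullet> (A *v x))"

(* The index type carries a linear order, which plays the role of 1 < ... < p. *)
definition strict_lower ::
  "real ^ ('n :: {finite, linorder}) ^ ('n :: {finite, linorder})
    \<Rightarrow> real ^ ('n :: {finite, linorder}) ^ ('n :: {finite, linorder})" where
  "strict_lower A = (\<chi> i j. if i > j then A $ i $ j else 0)"

definition A_WL :: "nat \<Rightarrow> real \<Rightarrow> real \<Rightarrow> real" where
  "A_WL p \<rho> \<kappa> =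
     2 * (\<rho> + 2 + \<rho> * sqrt (real p)) * (1 + \<kappa> * (2 + \<rho> * sqrt (real p)))"

definition chi_WL :: "nat \<Rightarrow> real \<Rightarrow> real \<Rightarrow> real" where
  "chi_WL p \<rho> \<kappa> = A_WL p \<rho> \<kappa> / (1 + A_WL p \<rho> \<kappa>)"

end

(* Both estimates go through the Frobenius norm: the spectral norm of T is at most its Frobenius
   norm, hence at most that of H. The columns of H are images of unit vectors, so their lengths are
   at most rho, and the Frobenius norm of H is at most rho sqrt p. The product defining A_WL contains
   the term 2 kappa (rho sqrt p)^2 together with strictly positive terms, and t / (1 + t) is
   increasing. *)
theory Submission
  imports Defs
begin

text \<open>The instance norm on \<open>real ^ 'n ^ 'm\<close> is the Frobenius norm.\<close>

lemma norm_matrix_squared: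
  fixes A :: "real ^ 'n ^ 'm"
  shows "(norm A)\<^sup>2 = (\<Sum>i\<in>UNIV. (norm (A $ i))\<^sup>2)"
  by (simp add: norm_vec_def L2_set_def sum_nonneg)

text \<open>Cauchy-Schwarz bounds each component of \<open>A *v x\<close> by the norm of the
  corresponding row times \<open>norm x\<close>; squaring and summing over the rows gives the
  claim.\<close>

lemma norm_matrix_vector_mult_le:
  fixes A :: "real ^ 'n ^ 'm"
  shows "norm (A *v x) \<le> norm A * norm x"
proof (rule power2_le_imp_le)
  have "(norm (A *v x))\<^sup>2 = (\<Sum>i\<in>UNIV. (A $ i \<bullet> x)\<^sup>2)"
    by (simp add: norm_vec_def L2_set_def sum_nonneg matrix_vector_mul_component)
  also have "\<dots> \<le> (\<Sum>i\<in>UNIV. (norm (A $ i) * norm x)\<^sup>2)"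
    by (intro sum_mono) (metis Cauchy_Schwarz_ineq2 abs_ge_zero power2_abs power_mono)
  also have "\<dots> = (norm A * norm x)\<^sup>2"
    by (simp add: norm_matrix_squared power_mult_distrib sum_distrib_right)
  finally show "(norm (A *v x))\<^sup>2 \<le> (norm A * norm x)\<^sup>2" .
qed simp

lemma spectral_norm_nonneg: "0 \<le> spectral_norm A"
  by (simp add: spectral_norm_def onorm_pos_le)

lemma spectral_norm_le_norm:
  fixes A :: "real ^ 'n ^ 'm"
  shows "spectral_norm A \<le> norm A"
  unfolding spectral_norm_def by (rule onorm_le) (rule norm_matrix_vector_mult_le)

lemma norm_column_le_spectral_norm:
  fixes A :: "real ^ 'n ^ 'm"
  shows "norm (column j A) \<le> spectral_norm A"
  using onorm[of "(*v) A" "axis j 1"]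
  by (simp add: spectral_norm_def matrix_vector_mult_basis norm_axis_1)

text \<open>Summing the squared entries by columns instead of rows makes the column bound
  applicable; the factor therefore counts columns.\<close>

lemma norm_matrix_le_spectral_norm:
  fixes A :: "real ^ 'n ^ 'm"
  shows "norm A \<le> spectral_norm A * sqrt CARD('n)"
proof (rule power2_le_imp_le)
  have "(norm A)\<^sup>2 = (\<Sum>i\<in>UNIV. \<Sum>j\<in>UNIV. (A $ i $ j)\<^sup>2)"
    by (simp add: norm_matrix_squared) (simp add: norm_vec_def L2_set_def sum_nonneg)
  also have "\<dots> = (\<Sum>j\<in>UNIV. \<Sum>i\<in>UNIV. (A $ i $ j)\<^sup>2)"
    by (rule sum.swap)
  also have "\<dots> = (\<Sum>j\<in>UNIV. (norm (column j A))\<^sup>2)"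
    by (simp add: norm_vec_def L2_set_def sum_nonneg column_def)
  also have "\<dots> \<le> (\<Sum>j\<in>(UNIV :: 'n set). (spectral_norm A)\<^sup>2)"
    by (intro sum_mono power_mono norm_column_le_spectral_norm) simp
  also have "\<dots> = (spectral_norm A * sqrt CARD('n))\<^sup>2"
    by (simp add: power_mult_distrib)
  finally show "(norm A)\<^sup>2 \<le> (spectral_norm A * sqrt CARD('n))\<^sup>2" .
qed (simp add: spectral_norm_nonneg)

text \<open>The Frobenius norm is monotone in the absolute values of the entries. Deleting entries
  can increase the spectral norm, hence the detour.\<close>

lemma norm_strict_lower_le: "norm (strict_lower A) \<le> norm A"
  unfolding strict_lower_def by (intro norm_le_componentwise_cart) auto

lemma divide_one_plus_strict_mono:
  fixes s t :: real
  assumes "0 \<le> s" "s < t"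
  shows "s / (1 + s) < t / (1 + t)"
  using assms by (simp add: field_simps)

theorem mainTheorem5:
  fixes H :: "real ^ ('n :: {finite, linorder}) ^ ('n :: {finite, linorder})" and \<kappa> :: real
  assumes "symmetric_psd H"
    and "\<And>i. H $ i $ i = 1"
    and "\<kappa> > 0"
  shows "2 * \<kappa> * (spectral_norm (strict_lower H))\<^sup>2
           / (1 + 2 * \<kappa> * (spectral_norm (strict_lower H))\<^sup>2)
         < chi_WL CARD('n) (spectral_norm H) \<kappa>"
proof -
  define \<rho> r where "\<rho> = spectral_norm H" and "r = \<rho> * sqrt CARD('n)"
  have nonneg: "0 \<le> \<rho>" "0 \<le> r"
    by (simp_all add: \<rho>_def r_def spectral_norm_nonneg)
  have "spectral_norm (strict_lower H) \<le> r"
    using spectral_norm_le_norm norm_strict_lower_le norm_matrix_le_spectral_norm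
    unfolding \<rho>_def r_def by (rule order_trans[OF order_trans])
  then have "2 * \<kappa> * (spectral_norm (strict_lower H))\<^sup>2 \<le> 2 * \<kappa> * r\<^sup>2"
    using assms(3) by (intro mult_left_mono power_mono spectral_norm_nonneg) auto
  \<comment> \<open>This splitting lets the product be compared factor by factor:
    \<open>2 * r\<close> falls short of the first factor of \<open>A_WL\<close> by at least 4, and
    \<open>\<kappa> * r\<close> of the second by more than 1.\<close>
  also have "\<dots> = 2 * r * (\<kappa> * r)"
    by (simp add: power2_eq_square)
  also have "\<dots> < 2 * (\<rho> + 2 + r) * (1 + \<kappa> * (2 + r))"
    by (rule mult_strict_mono') (use nonneg assms(3) in \<open>auto simp: algebra_simps add_pos_nonneg\<close>)
  finally have "2 * \<kappa> * (spectral_norm (strict_lower H))\<^sup>2 < A_WL CARD('n) \<rho> \<kappa>"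
    by (simp add: A_WL_def r_def)
  then show ?thesis
    unfolding chi_WL_def \<rho>_def using assms(3) by (intro divide_one_plus_strict_mono) auto
qed

end
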